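(* The 11-dimensional Cohn-Elkies linear programming bound (i.e., the Cohn-Elkies linear programming bound in $\mathbb{R}^{11}$) is greater than or equal to $\frac{1}{24}>0.04166666$.
   Context: Fourier transform on $\mathbb{R}^d$: $\widehat f(y)=\int_{\mathbb{R}^d} f(x)e^{-2\pi i\langle x,y\rangle}\,dx$, where $\langle x,y\rangle=x_1y_1+\cdots+x_dy_d$. A function $f:\mathbb{R}^d\to\mathbb{R}$ is rapidly decreasing if $f(x)=O\left((1+|x|)^{-k}\right)$ for all positive integers $k$; it is radial if $f(x)$ depends only on $|x|$. For fixed $r>0$ and positive integer $d$, the Cohn-Elkies linear programming bound in $\mathbb{R}^d$ is the infimum of $\left(\frac r2\right)^d f(0)$ over all radial, smooth, rapidly decreasing functions $f:\mathbb{R}^d\to\mathbb{R}$ such that $f(0)>0$; $\widehat f(0)\geq 1$; $f(x)\leq 0$ for all $|x|\geq r$; and $\widehat f(y)\geq 0$ for all $y\in\mathbb{R}^d$. This value does not depend on $r$ (by rescaling $f$). *)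

theory Defs
  imports "HOL-Analysis.Analysis"
begin

definition fourier_transform :: "(real^'n \<Rightarrow> real) \<Rightarrow> real^'n \<Rightarrow> complex"
  where "fourier_transform f y =
    (LINT x|lborel. complex_of_real (f x) * exp (- 2 * complex_of_real pi * \<i> * complex_of_real (x \<bullet> y)))"

definition rapidly_decreasing :: "(real^'n \<Rightarrow> real) \<Rightarrow> bool"
  where "rapidly_decreasing f \<longleftrightarrow>
    (\<forall>k::nat. k > 0 \<longrightarrow> (\<exists>C. \<forall>x. \<bar>f x\<bar> \<le> C * inverse ((1 + norm x) ^ k)))"

definition radial :: "(real^'n \<Rightarrow> real) \<Rightarrow> bool"
  where "radial f \<longleftrightarrow> (\<forall>x y. norm x = norm y \<longrightarrow> f x = f y)"

text \<open>\<open>times_cont_diff k f\<close> says that \<open>f\<close> is of class \<open>C\<^sup>k\<close> on the whole space;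
  \<open>frechet_derivative f (at x) v\<close> is the directional derivative of \<open>f\<close> at \<open>x\<close> along \<open>v\<close>.\<close>

primrec times_cont_diff :: "nat \<Rightarrow> (real^'n \<Rightarrow> real) \<Rightarrow> bool"
  where
    "times_cont_diff 0 f \<longleftrightarrow> continuous_on UNIV f"
  | "times_cont_diff (Suc k) f \<longleftrightarrow>
      (\<forall>x. f differentiable (at x)) \<and>
      (\<forall>v. times_cont_diff k (\<lambda>x. frechet_derivative f (at x) v))"

definition smooth :: "(real^'n \<Rightarrow> real) \<Rightarrow> bool"
  where "smooth f \<longleftrightarrow> (\<forall>k. times_cont_diff k f)"

text \<open>The Fourier transform is complex-valued (for radial real \<open>f\<close> it is in fact real), so an
  inequality for it is rendered as membership in the reals together with the inequality for the
  real part.\<close>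

definition cohn_elkies_feasible :: "real \<Rightarrow> (real^'n \<Rightarrow> real) set"
  where "cohn_elkies_feasible r =
    {f. radial f \<and> smooth f \<and> rapidly_decreasing f \<and>
        f 0 > 0 \<and>
        (fourier_transform f 0 \<in> \<real> \<and> Re (fourier_transform f 0) \<ge> 1) \<and>
        (\<forall>x. norm x \<ge> r \<longrightarrow> f x \<le> 0) \<and>
        (\<forall>y. fourier_transform f y \<in> \<real> \<and> Re (fourier_transform f y) \<ge> 0)}"

text \<open>The infimum is taken in the extended reals, where it is meaningful without first knowing
  that the set is nonempty. The dimension is that of the index type \<open>'n\<close>.\<close>

definition cohn_elkies_bound :: "'n::finite itself \<Rightarrow> real \<Rightarrow> ereal"
  where "cohn_elkies_bound _ r =
    (INF f \<in> (cohn_elkies_feasible r :: (real^'n \<Rightarrow> real) set).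
       ereal ((r / 2) ^ CARD('n) * f 0))"

end

theory Submission
  imports Defs "HOL-Computational_Algebra.Polynomial"
begin

text \<open>
  The bound comes from Delsarte's linear programming bound for binary codes of length 11 and
  distance 4, transported to Euclidean space by Construction A.

  Let \<open>w\<close> be a nonnegative function on the subsets \<open>U\<close> of the coordinates (the vectors of
  \<open>F\<^sub>2\<^sup>1\<^sup>1\<close>) with \<open>w {} = 1\<close>, vanishing on nonempty sets with fewer than 4 elements, and with
  nonnegative character sums. Put the mass \<open>w U\<close> on every point of the coset
  \<open>(r/2) (1\<^sub>U + 2 \<int>\<^sup>n)\<close>. Every nonzero point that carries mass has norm at least \<open>r\<close>, so \<open>f\<close> is
  nonpositive there and the integral of \<open>f\<close> against this measure is at most \<open>f 0\<close>. By Poisson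
  summation the same integral is a sum of nonnegative multiples of values of the Fourier transform,
  in which the value at \<open>0\<close> has the coefficient \<open>r\<^sup>-\<^sup>n (\<Sum>U. w U)\<close>. Hence
  \<open>r\<^sup>n f 0 \<ge> (\<Sum>U. w U)\<close>, which is \<open>delsarte_weight_bound\<close>.

  Poisson summation is not applied to \<open>f\<close> itself, whose derivatives and Fourier transform carry no
  explicit decay. Instead each point mass is smeared out: the lattice sum of delta functions
  is replaced by a multiple of the nonnegative trigonometric polynomial
  \<open>\<Prod>\<^sub>i cos(\<pi> x\<^sub>i / r)\<^sup>2\<^sup>N\<close>, which has nonnegative Fourier coefficients and concentrates on
  \<open>r \<int>\<^sup>n\<close> as \<open>N\<close> grows. Expanding it into exponentials gives the lower estimate
  \<open>sum_integral_cos_kernel_ge\<close> as a finite sum. For the upper estimate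
  \<open>integral_cos_kernel_le\<close> only the box \<open>\<bar>x\<^sub>i\<bar> \<le> r\<close> matters, because \<open>f\<close> is nonpositive
  outside it; there \<open>f\<close> is majorised by a function whose integral against the kernel is explicit.

  For \<open>n = 11\<close> the weights in \<open>code_weight\<close>, an optimal solution of the Delsarte linear program
  with even distances, have total mass \<open>256 / 3\<close>, and \<open>(256 / 3) / 2\<^sup>1\<^sup>1 = 1 / 24\<close>.
\<close>

section \<open>Even powers of the cosine\<close>

text \<open>The mean of \<open>cos\<^sup>2\<^sup>N\<close> over a period, that is, its constant Fourier coefficient.\<close>

definition cos_mean :: "nat \<Rightarrow> real"
  where "cos_mean N = real ((2 * N) choose N) / 4 ^ N"

lemma cos_mean_pos: "cos_mean N > 0"
  by (simp add: cos_mean_def)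

text \<open>As \<open>sin\<^sup>2 cos\<^sup>2\<^sup>N = cos\<^sup>2\<^sup>N - cos\<^sup>2\<^sup>N\<^sup>+\<^sup>2\<close>, this difference is the mean of
  \<open>sin\<^sup>2 cos\<^sup>2\<^sup>N\<close>. That it is small compared with \<open>cos_mean N\<close> says that the kernel
  concentrates where the sine vanishes, and replaces any estimate of the tails of the kernel.\<close>

lemma cos_mean_Suc: "cos_mean N - cos_mean (Suc N) = cos_mean N / (2 * real N + 2)"
proof -
  have "Suc N * Suc N * ((2 * Suc N) choose (Suc N)) = (2 * N + 2) * (2 * N + 1) * ((2 * N) choose N)"
  proof -
    have 1: "Suc N * ((2 * Suc N) choose (Suc N)) = (2 * N + 2) * ((2 * N + 1) choose N)"
      using Suc_times_binomial_eq[of "2 * N + 1" N] by (simp add: ac_simps)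
    have 2: "Suc N * ((2 * N + 1) choose N) = (2 * N + 1) * ((2 * N) choose N)"
    proof -
      have "(2 * N + 1) choose N = (2 * N + 1) choose (Suc N)"
        using binomial_symmetric[of N "2 * N + 1"] by simp
      then show ?thesis
        using Suc_times_binomial_eq[of "2 * N" N] by (simp add: ac_simps)
    qed
    have "Suc N * Suc N * ((2 * Suc N) choose (Suc N)) = Suc N * ((2 * N + 2) * ((2 * N + 1) choose N))"
      by (simp only: 1 mult.assoc)
    also have "\<dots> = (2 * N + 2) * (Suc N * ((2 * N + 1) choose N))"
      by (simp only: ac_simps)
    also have "\<dots> = (2 * N + 2) * (2 * N + 1) * ((2 * N) choose N)"
      by (simp only: 2 mult.assoc)
    finally show ?thesis .
  qed
  then have "real (Suc N * Suc N * ((2 * Suc N) choose (Suc N)))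
      = real ((2 * N + 2) * (2 * N + 1) * ((2 * N) choose N))"
    by (simp only:)
  then have "(real N + 1) * ((real N + 1) * real ((2 * Suc N) choose (Suc N)))
      = (real N + 1) * (2 * (2 * real N + 1) * real ((2 * N) choose N))"
    by (simp add: algebra_simps del: binomial_Suc_Suc)
  then have "(real N + 1) * real ((2 * Suc N) choose (Suc N)) = 2 * (2 * real N + 1) * real ((2 * N) choose N)"
    by (metis mult_cancel_left add_pos_nonneg of_nat_0_le_iff zero_less_one add.commute less_numeral_extra(3))
  then have *: "real ((2 * Suc N) choose (Suc N)) = 2 * (2 * real N + 1) * real ((2 * N) choose N) / (real N + 1)"
    by (simp add: field_simps del: binomial_Suc_Suc)
  have "C / p - (2 * (2 * x + 1) * C / (x + 1)) / (4 * p) = C / p / (2 * x + 2)"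
    if "x \<ge> 0" "p > 0" for C p x :: real
    using that by (simp add: add_nonneg_eq_0_iff divide_simps algebra_simps)
  then show ?thesis
    unfolding cos_mean_def * power_Suc by simp
qed

text \<open>The binomial theorem for \<open>((cis \<theta> + cis (- \<theta>)) / 2)\<^sup>2\<^sup>N\<close>; the essential point is that
  all coefficients are nonnegative.\<close>

lemma cos_power_eq_cis_sum:
  "complex_of_real (cos \<theta> ^ (2 * N)) =
    (\<Sum>j\<le>2 * N. complex_of_real (real ((2 * N) choose j) / 4 ^ N) * cis (2 * (real j - real N) * \<theta>))"
proof -
  have "complex_of_real (cos \<theta>) = (cis \<theta> + cis (- \<theta>)) / 2"
    by (simp add: complex_eq_iff)
  then have "complex_of_real (cos \<theta> ^ (2 * N)) = ((cis \<theta> + cis (- \<theta>)) / 2) ^ (2 * N)"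
    by (simp only: of_real_power)
  also have "\<dots> = (cis \<theta> + cis (- \<theta>)) ^ (2 * N) / 4 ^ N"
    by (simp add: power_divide power_mult)
  also have "(cis \<theta> + cis (- \<theta>)) ^ (2 * N)
      = (\<Sum>j\<le>2 * N. of_nat ((2 * N) choose j) * cis \<theta> ^ j * cis (- \<theta>) ^ (2 * N - j))"
    by (rule binomial_ring)
  also have "\<dots> = (\<Sum>j\<le>2 * N. of_nat ((2 * N) choose j) * cis (2 * (real j - real N) * \<theta>))"
  proof (rule sum.cong)
    fix j assume "j \<in> {..2 * N}"
    then have "cis \<theta> ^ j * cis (- \<theta>) ^ (2 * N - j) = cis (2 * (real j - real N) * \<theta>)"
      by (simp add: Complex.DeMoivre cis_mult of_nat_diff algebra_simps)
    then show "of_nat ((2 * N) choose j) * cis \<theta> ^ j * cis (- \<theta>) ^ (2 * N - j)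
      = of_nat ((2 * N) choose j) * cis (2 * (real j - real N) * \<theta>)"
      by (simp add: mult.assoc)
  qed simp
  finally show ?thesis
    by (simp add: sum_divide_distrib)
qed

lemma cos_power_eq_cos_sum:
  "cos \<theta> ^ (2 * N) = (\<Sum>j\<le>2 * N. real ((2 * N) choose j) / 4 ^ N * cos (2 * (real j - real N) * \<theta>))"
proof -
  have "cos \<theta> ^ (2 * N) = Re (complex_of_real (cos \<theta> ^ (2 * N)))"
    by (simp only: Re_complex_of_real)
  then show ?thesis
    unfolding cos_power_eq_cis_sum by simp
qed

lemma has_bochner_integral_cos_periods:
  fixes r b c :: real and m :: nat and k :: int
  assumes r: "r > 0"
  shows "has_bochner_integral lborel
    (\<lambda>t. indicator {c..c + real m * r} t * cos (2 * of_int k * (pi * (t - b) / r)))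
    (if k = 0 then real m * r else 0)"
proof (cases "k = 0")
  case True
  have "has_bochner_integral lborel (indicator {c..c + real m * r} :: real \<Rightarrow> real) (measure lborel {c..c + real m * r})"
    by (intro has_bochner_integral_real_indicator) (auto simp: emeasure_lborel_Icc_eq)
  with True r show ?thesis by simp
next
  case False
  let ?F = "\<lambda>t. r / (2 * of_int k * pi) * sin (2 * of_int k * (pi * (t - b) / r))"
  have "has_bochner_integral lborel
    (\<lambda>t. indicator {c..c + real m * r} t *\<^sub>R cos (2 * of_int k * (pi * (t - b) / r)))
    (?F (c + real m * r) - ?F c)"
  proof (rule has_bochner_integral_FTC_Icc)
    show "c \<le> c + real m * r" using r by simp
    show "continuous_on {c..c + real m * r} (\<lambda>t. cos (2 * of_int k * (pi * (t - b) / r)))"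
      using r by (intro continuous_intros) auto
    show "(?F has_vector_derivative cos (2 * of_int k * (pi * (t - b) / r))) (at t within {c..c + real m * r})" for t
      unfolding has_real_derivative_iff_has_vector_derivative[symmetric]
      using r False by (auto intro!: derivative_eq_intros simp: field_simps)
  qed
  moreover have "?F (c + real m * r) = ?F c"
  proof -
    have "2 * of_int k * (pi * (c + real m * r - b) / r)
        = 2 * of_int k * (pi * (c - b) / r) + 2 * pi * of_int (k * int m)"
      using r by (simp add: field_simps)
    then have "sin (2 * of_int k * (pi * (c + real m * r - b) / r)) = sin (2 * of_int k * (pi * (c - b) / r))"
      by (simp only: sin_add sin_int_2pin cos_int_2pin)
    then show ?thesis by simp
  qed
  ultimately show ?thesis
    using False by (simp only: diff_self real_scaleR_def if_False)
qed

lemma has_bochner_integral_cos_power_periods: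
  fixes r b c :: real and m N :: nat
  assumes r: "r > 0"
  shows "has_bochner_integral lborel
    (\<lambda>t. indicator {c..c + real m * r} t * cos (pi * (t - b) / r) ^ (2 * N)) (real m * r * cos_mean N)"
proof -
  have "has_bochner_integral lborel
    (\<lambda>t. \<Sum>j\<le>2 * N. real ((2 * N) choose j) / 4 ^ N *
      (indicator {c..c + real m * r} t * cos (2 * of_int (int j - int N) * (pi * (t - b) / r))))
    (\<Sum>j\<le>2 * N. real ((2 * N) choose j) / 4 ^ N * (if int j - int N = 0 then real m * r else 0))"
    by (intro has_bochner_integral_sum has_bochner_integral_mult_right has_bochner_integral_cos_periods r)
  moreover have "(\<Sum>j\<le>2 * N. real ((2 * N) choose j) / 4 ^ N * (if int j - int N = 0 then real m * r else 0))
      = (\<Sum>j\<le>2 * N. if j = N then real ((2 * N) choose N) / 4 ^ N * (real m * r) else 0)"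
    by (intro sum.cong) auto
  then have "(\<Sum>j\<le>2 * N. real ((2 * N) choose j) / 4 ^ N * (if int j - int N = 0 then real m * r else 0))
      = real m * r * cos_mean N"
    by (simp add: cos_mean_def)
  moreover have "(\<lambda>t. indicator {c..c + real m * r} t * cos (pi * (t - b) / r) ^ (2 * N)) =
    (\<lambda>t. \<Sum>j\<le>2 * N. real ((2 * N) choose j) / 4 ^ N *
      (indicator {c..c + real m * r} t * cos (2 * of_int (int j - int N) * (pi * (t - b) / r))))"
    by (simp only: cos_power_eq_cos_sum sum_distrib_left) (simp only: of_int_diff of_int_of_nat_eq mult_ac)
  ultimately show ?thesis by (simp only:)
qed

text \<open>Tonelli's theorem for a product of functions of the single coordinates.\<close>

lemma has_bochner_integral_prod_coordinates:
  fixes h :: "'n::finite \<Rightarrow> real \<Rightarrow> real"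
  assumes nonneg: "\<And>i t. h i t \<ge> 0"
    and int: "\<And>i. has_bochner_integral lborel (h i) (c i)"
  shows "has_bochner_integral lborel (\<lambda>x::real^'n. \<Prod>i\<in>UNIV. h i (x $ i)) (\<Prod>i\<in>UNIV. c i)"
proof (rule has_bochner_integral_nn_integral)
  have [measurable]: "h i \<in> borel_measurable borel" for i
    using int[of i] by (auto elim: has_bochner_integral.cases)
  have c: "c i \<ge> 0" for i
    using int[of i] Bochner_Integration.integral_nonneg[of lborel "h i"] nonneg
    by (auto simp: has_bochner_integral_iff)
  show "(\<lambda>x::real^'n. \<Prod>i\<in>UNIV. h i (x $ i)) \<in> borel_measurable lborel"
    by measurable
  show "AE x in lborel. 0 \<le> (\<Prod>i\<in>UNIV. h i (x $ i))"
    by (simp add: nonneg prod_nonneg)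
  show "0 \<le> (\<Prod>i\<in>UNIV. c i)"
    by (simp add: c prod_nonneg)
  \<comment> \<open>The product formula for Lebesgue measure is indexed by the basis vectors; \<open>idx\<close> translates
    them back to coordinate indices.\<close>
  define idx :: "real^'n \<Rightarrow> 'n" where "idx b = (SOME i. b = axis i 1)" for b
  have idx [simp]: "idx (axis i 1) = i" for i
    by (simp add: idx_def axis_eq_axis)
  have Basis: "Basis = range (\<lambda>i::'n. axis i (1::real))"
    by (auto simp: Basis_vec_def)
  have inj: "inj (\<lambda>i::'n. axis i (1::real))"
    by (auto simp: inj_def axis_eq_axis)
  have "(\<integral>\<^sup>+x. ennreal (\<Prod>i\<in>UNIV. h i (x $ i)) \<partial>(lborel :: (real^'n) measure))
      = (\<integral>\<^sup>+x. (\<Prod>b\<in>Basis. ennreal (h (idx b) (x \<bullet> b))) \<partial>(lborel :: (real^'n) measure))"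
    by (simp add: Basis prod.reindex[OF inj] prod_ennreal nonneg inner_axis)
  also have "\<dots> = (\<Prod>b\<in>(Basis::(real^'n) set). \<integral>\<^sup>+t. ennreal (h (idx b) t) \<partial>lborel)"
    by (rule nn_integral_lborel_prod) (auto simp: nonneg)
  also have "\<dots> = (\<Prod>i\<in>(UNIV::'n set). \<integral>\<^sup>+t. ennreal (h i t) \<partial>lborel)"
    by (simp add: Basis prod.reindex[OF inj])
  also have "\<dots> = (\<Prod>i\<in>(UNIV::'n set). ennreal (c i))"
    using int nonneg by (simp add: nn_integral_eq_integral has_bochner_integral_iff)
  finally show "(\<integral>\<^sup>+x. ennreal (\<Prod>i\<in>UNIV. h i (x $ i)) \<partial>(lborel :: (real^'n) measure)) = ennreal (\<Prod>i\<in>UNIV. c i)"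
    by (simp add: prod_ennreal c)
qed

section \<open>The kernel and the cosets of Construction A\<close>

text \<open>The representative in \<open>{0, r/2}\<^sup>n\<close> of the coset of \<open>r \<int>\<^sup>n\<close> that the code word \<open>U\<close> selects in
  Construction A.\<close>

definition half_shift :: "real \<Rightarrow> 'n set \<Rightarrow> real^'n"
  where "half_shift r U = (\<chi> i. if i \<in> U then r / 2 else 0)"

definition cos_kernel :: "real \<Rightarrow> nat \<Rightarrow> real^'n \<Rightarrow> real"
  where "cos_kernel r N x = (\<Prod>i\<in>UNIV. cos (pi * x $ i / r) ^ (2 * N))"

lemma cos_kernel_nonneg: "cos_kernel r N x \<ge> 0"
  by (simp add: cos_kernel_def prod_nonneg power_mult)

lemma sin_small_imp_near_multiple:
  fixes t r \<delta> :: real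
  assumes r: "r > 0" and \<delta>: "0 < \<delta>" "\<delta> \<le> r / 2"
    and small: "\<bar>sin (pi * t / r)\<bar> < sin (pi * \<delta> / r)"
  obtains z :: int where "\<bar>t - r * of_int z\<bar> < \<delta>"
proof
  \<comment> \<open>Reduction of \<open>t\<close> to a fundamental period around \<open>0\<close>, where the sine is monotone.\<close>
  define z where "z = round (t / r)"
  define \<tau> where "\<tau> = t - r * of_int z"
  have "\<bar>of_int z - t / r\<bar> \<le> 1 / 2"
    unfolding z_def by (rule of_int_round_abs_le)
  moreover have "\<tau> = - (r * (of_int z - t / r))"
    using r by (simp add: \<tau>_def algebra_simps)
  ultimately have \<tau>: "\<bar>\<tau>\<bar> \<le> r / 2"
    using r by (simp add: abs_mult)
  have "pi * t / r = pi * \<tau> / r + pi * of_int z"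
    using r by (simp add: \<tau>_def field_simps)
  then have "\<bar>sin (pi * t / r)\<bar> = \<bar>sin (pi * \<tau> / r)\<bar>"
    by (simp add: sin_add cos_npi_int abs_mult)
  also have "\<dots> \<ge> sin (pi * \<bar>\<tau>\<bar> / r)"
    by (cases "\<tau> \<ge> 0") auto
  finally have *: "sin (pi * \<bar>\<tau>\<bar> / r) < sin (pi * \<delta> / r)"
    using small by simp
  show "\<bar>t - r * of_int z\<bar> < \<delta>"
  proof (rule ccontr)
    assume "\<not> \<bar>t - r * of_int z\<bar> < \<delta>"
    then have "\<delta> \<le> \<bar>\<tau>\<bar>" by (simp add: \<tau>_def)
    then have "sin (pi * \<delta> / r) \<le> sin (pi * \<bar>\<tau>\<bar> / r)"
      using r \<delta> \<tau> by (intro sin_monotone_2pi_le) (auto simp: field_simps intro: order_trans[of _ 0])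
    with * show False by simp
  qed
qed

text \<open>The minimum distance of Construction A: a nonzero vector of \<open>r \<int>\<^sup>n\<close> has a coordinate of
  modulus at least \<open>r\<close>, and a vector over a code word of weight at least 4 has four coordinates
  that are odd multiples of \<open>r/2\<close>, hence squared norm at least \<open>4 (r/2)\<^sup>2\<close>.\<close>

lemma norm_half_lattice_ge:
  fixes U :: "'n::finite set" and z :: "'n \<Rightarrow> int" and p :: "real^'n"
  assumes r: "r > 0" and U: "U = {} \<or> card U \<ge> 4"
    and p: "\<And>i. p $ i = half_shift r U $ i + r * of_int (z i)"
    and "p \<noteq> 0"
  shows "norm p \<ge> r"
  using U
proof
  assume [simp]: "U = {}"
  from \<open>p \<noteq> 0\<close> obtain i where "p $ i \<noteq> 0"
    by (auto simp: vec_eq_iff)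
  then have "z i \<noteq> 0"
    by (auto simp: p half_shift_def)
  then have "\<bar>of_int (z i) :: real\<bar> \<ge> 1"
    by linarith
  then have "r \<le> \<bar>p $ i\<bar>"
    using r by (simp add: p half_shift_def abs_mult)
  also have "\<dots> \<le> norm p"
    by (rule component_le_norm_cart)
  finally show ?thesis .
next
  assume U: "card U \<ge> 4"
  have "r\<^sup>2 = 4 * (r / 2)\<^sup>2"
    by (simp add: power2_eq_square)
  also have "\<dots> \<le> real (card U) * (r / 2)\<^sup>2"
    using U by (intro mult_right_mono) auto
  also have "\<dots> = (\<Sum>i\<in>U. (r / 2)\<^sup>2)"
    by simp
  also have "\<dots> \<le> (\<Sum>i\<in>U. (p $ i)\<^sup>2)"
  proof (rule sum_mono)
    fix i assume "i \<in> U"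
    then have "p $ i = r / 2 * of_int (2 * z i + 1)"
      by (simp add: p half_shift_def algebra_simps)
    moreover have "2 * z i + 1 \<noteq> 0"
      by presburger
    then have "\<bar>of_int (2 * z i + 1) :: real\<bar> \<ge> 1"
      by linarith
    ultimately have "\<bar>r / 2\<bar> \<le> \<bar>p $ i\<bar>"
      using r by (simp only: abs_mult) (simp add: mult_le_cancel_left)
    then show "(r / 2)\<^sup>2 \<le> (p $ i)\<^sup>2"
      by (simp only: abs_le_square_iff)
  qed
  also have "\<dots> \<le> (\<Sum>i\<in>UNIV. (p $ i)\<^sup>2)"
    by (rule sum_mono2) auto
  also have "\<dots> = (norm p)\<^sup>2"
    unfolding power2_norm_eq_inner by (simp add: inner_vec_def power2_eq_square)
  finally show ?thesis
    using r by (simp add: power2_le_iff_abs_le)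
qed

text \<open>If the sum of the squared sines is not small, the last summand alone is at least the maximum of \<open>f\<close>
  on a compact set. If it is small, then \<open>x\<close> is close to a point \<open>p\<close> of the coset of \<open>U\<close>, and uniform
  continuity gives \<open>f x \<le> f p + \<epsilon>\<close>; here \<open>f p \<le> 0\<close> unless \<open>p = 0\<close>, which forces \<open>U = {}\<close>. The
  half-size box around \<open>0\<close> contains just one period of the kernel, so that \<open>f 0\<close> will be counted
  once only.\<close>

lemma pointwise_majorant:
  fixes f :: "real^'n::finite \<Rightarrow> real"
  assumes r: "r > 0" and cont: "continuous_on UNIV f" and f0: "f 0 \<ge> 0"
    and neg: "\<And>x. norm x \<ge> r \<Longrightarrow> f x \<le> 0" and \<epsilon>: "\<epsilon> > 0"
  obtains C where "C \<ge> 0"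
    and "\<And>U x. U = {} \<or> card U \<ge> 4 \<Longrightarrow> (\<And>i. \<bar>x $ i\<bar> \<le> r) \<Longrightarrow>
      f x \<le> (if U = {} \<and> (\<forall>i. \<bar>x $ i\<bar> \<le> r / 2) then f 0 else 0) + \<epsilon>
        + C * (\<Sum>i\<in>UNIV. (sin (pi * (x - half_shift r U) $ i / r))\<^sup>2)"
proof -
  define n where "n = real CARD('n)"
  have n: "n \<ge> 1"
    using one_le_card_finite[where 'a='n] unfolding n_def by linarith
  \<comment> \<open>Twice the box of the claim, so that it also contains the nearby coset points.\<close>
  define K :: "(real^'n) set" where "K = cbox (\<chi> i. - 2 * r) (\<chi> i. 2 * r)"
  have K: "x \<in> K \<longleftrightarrow> (\<forall>i. \<bar>x $ i\<bar> \<le> 2 * r)" for x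
    by (auto simp: K_def mem_box_cart abs_le_iff) (metis minus_le_iff)+
  have "compact K"
    by (simp add: K_def)
  have contK: "continuous_on K f"
    using cont by (rule continuous_on_subset) simp
  with \<open>compact K\<close> have "uniformly_continuous_on K f"
    by (intro compact_uniformly_continuous)
  then obtain d where d: "d > 0"
    and close: "\<And>x p. x \<in> K \<Longrightarrow> p \<in> K \<Longrightarrow> dist x p < d \<Longrightarrow> dist (f x) (f p) < \<epsilon>"
    using \<epsilon> unfolding uniformly_continuous_on_def by metis
  define \<delta> where "\<delta> = min (d / n) (r / 2)"
  have \<delta>: "0 < \<delta>" "\<delta> \<le> r / 2" "n * \<delta> \<le> d"
    using d n r by (auto simp: \<delta>_def min_def field_simps)
  have "compact (f ` K)"
    using contK \<open>compact K\<close> by (rule compact_continuous_image)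
  then obtain M where M: "\<And>x. x \<in> K \<Longrightarrow> \<bar>f x\<bar> \<le> M"
    using compact_imp_bounded[of "f ` K"] unfolding bounded_iff by auto
  have "0 \<in> K"
    using r by (simp add: K)
  from M[OF this] have M0: "M \<ge> 0" by linarith
  define \<eta> where "\<eta> = (sin (pi * \<delta> / r))\<^sup>2"
  have sin_pos: "sin (pi * \<delta> / r) > 0"
  proof (rule sin_gt_zero)
    show "0 < pi * \<delta> / r" using \<delta> r by simp
    have "\<delta> < r" using \<delta> r by linarith
    then show "pi * \<delta> / r < pi" using r by (simp add: field_simps)
  qed
  then have \<eta>: "\<eta> > 0"
    by (simp add: \<eta>_def)
  show ?thesis
  proof
    show "M / \<eta> \<ge> 0"
      using M0 \<eta> by simp
  next
    fix U :: "'n set" and x :: "real^'n"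
    assume U: "U = {} \<or> card U \<ge> 4" and x: "\<And>i. \<bar>x $ i\<bar> \<le> r"
    define \<Sigma> where "\<Sigma> = (\<Sum>i\<in>UNIV. (sin (pi * (x - half_shift r U) $ i / r))\<^sup>2)"
    have \<Sigma>0: "\<Sigma> \<ge> 0"
      by (simp add: \<Sigma>_def sum_nonneg)
    have xK: "x \<in> K"
    proof -
      have "\<bar>x $ i\<bar> \<le> 2 * r" for i
        using x[of i] r by linarith
      then show ?thesis by (simp add: K)
    qed
    have "f x \<le> (if U = {} \<and> (\<forall>i. \<bar>x $ i\<bar> \<le> r / 2) then f 0 else 0) + \<epsilon> + M / \<eta> * \<Sigma>"
    proof (cases "\<Sigma> \<ge> \<eta>")
      case True
      have "f x \<le> M"
        using M[OF xK] by simp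
      also have "\<dots> = M / \<eta> * \<eta>"
        using \<eta> by simp
      also have "\<dots> \<le> M / \<eta> * \<Sigma>"
        using True M0 \<eta> by (intro mult_left_mono) auto
      finally show ?thesis
        using f0 \<epsilon> by auto
    next
      case False
      have "\<exists>z::int. \<bar>(x - half_shift r U) $ i - r * of_int z\<bar> < \<delta>" for i
      proof -
        have "(sin (pi * (x - half_shift r U) $ i / r))\<^sup>2 \<le> \<Sigma>"
          unfolding \<Sigma>_def by (rule member_le_sum) auto
        with False have "(sin (pi * (x - half_shift r U) $ i / r))\<^sup>2 < (sin (pi * \<delta> / r))\<^sup>2"
          unfolding \<eta>_def by linarith
        then have "\<bar>sin (pi * (x - half_shift r U) $ i / r)\<bar> < sin (pi * \<delta> / r)"
          using sin_pos by (metis abs_of_pos power2_abs power2_less_imp_less order_less_imp_le)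
        then show ?thesis
          using sin_small_imp_near_multiple[OF r \<delta>(1,2)] by blast
      qed
      then obtain z :: "'n \<Rightarrow> int"
        where z: "\<And>i. \<bar>(x - half_shift r U) $ i - r * of_int (z i)\<bar> < \<delta>"
        by metis
      define p :: "real^'n" where "p = (\<chi> i. half_shift r U $ i + r * of_int (z i))"
      have p: "p $ i = half_shift r U $ i + r * of_int (z i)" for i
        by (simp add: p_def)
      have xp: "\<bar>x $ i - p $ i\<bar> < \<delta>" for i
        using z[of i] by (simp add: p algebra_simps)
      have pK: "p \<in> K"
        unfolding K
      proof
        fix i show "\<bar>p $ i\<bar> \<le> 2 * r"
          using xp[of i] x[of i] \<delta>(2) r by linarith
      qed
      have "dist x p \<le> (\<Sum>i\<in>UNIV. \<bar>(x - p) $ i\<bar>)"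
        unfolding dist_norm by (rule norm_le_l1_cart)
      also have "\<dots> < (\<Sum>i\<in>(UNIV::'n set). \<delta>)"
        using xp by (intro sum_strict_mono) auto
      also have "\<dots> \<le> d"
        using \<delta>(3) by (simp add: n_def)
      finally have "dist (f x) (f p) < \<epsilon>"
        by (rule close[OF xK pK])
      then have fx: "f x \<le> f p + \<epsilon>"
        by (simp add: dist_real_def)
      have C\<Sigma>: "M / \<eta> * \<Sigma> \<ge> 0"
        using M0 \<eta> \<Sigma>0 by simp
      show ?thesis
      proof (cases "p = 0")
        case True
        have "U = {}"
        proof (rule ccontr)
          assume "U \<noteq> {}"
          then obtain i where "i \<in> U" by auto
          with True p[of i] have "r * of_int (2 * z i + 1) = 0"
            by (simp add: half_shift_def algebra_simps)
          with r have "real_of_int (2 * z i + 1) = 0" by simp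
          then have "2 * z i + 1 = 0" by (simp only: of_int_eq_0_iff)
          then show False by presburger
        qed
        moreover have "\<bar>x $ i\<bar> \<le> r / 2" for i
          using xp[of i] \<delta>(2) True by simp
        ultimately show ?thesis
          using fx C\<Sigma> True by simp
      next
        case False
        have "f p \<le> 0"
          by (rule neg) (rule norm_half_lattice_ge[OF r U p False])
        then show ?thesis
          using fx C\<Sigma> f0 by auto
      qed
    qed
    then show "f x \<le> (if U = {} \<and> (\<forall>i. \<bar>x $ i\<bar> \<le> r / 2) then f 0 else 0) + \<epsilon>
        + M / \<eta> * (\<Sum>i\<in>UNIV. (sin (pi * (x - half_shift r U) $ i / r))\<^sup>2)"
      unfolding \<Sigma>_def .
  qed
qed

section \<open>Estimating the smoothed sums from both sides\<close>

text \<open>The majorant is integrated term by term. Over one period in each coordinate the kernel has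
  integral \<open>(r cos_mean N)\<^sup>n\<close>, and over the box of side \<open>2 r\<close> it has \<open>2\<^sup>n\<close> times as much; a
  squared sine in one coordinate contributes a further factor \<open>1 / (2 N + 2)\<close>. The factor
  \<open>cos_mean N ^ n\<close> is common to this upper and the later lower estimate and cancels.\<close>

lemma integral_cos_kernel_le:
  fixes f :: "real^'n::finite \<Rightarrow> real" and U :: "'n set"
  assumes r: "r > 0" and int: "integrable lborel f" and f0: "f 0 \<ge> 0" and \<epsilon>: "\<epsilon> \<ge> 0" and C: "C \<ge> 0"
    and neg: "\<And>x. norm x \<ge> r \<Longrightarrow> f x \<le> 0"
    and maj: "\<And>x. (\<And>i. \<bar>x $ i\<bar> \<le> r) \<Longrightarrow>
      f x \<le> (if U = {} \<and> (\<forall>i. \<bar>x $ i\<bar> \<le> r / 2) then f 0 else 0) + \<epsilon>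
        + C * (\<Sum>i\<in>UNIV. (sin (pi * (x - half_shift r U) $ i / r))\<^sup>2)"
  shows "(LINT x|lborel. f x * cos_kernel r N (x - half_shift r U))
    \<le> cos_mean N ^ CARD('n) * ((if U = {} then r ^ CARD('n) * f 0 else 0)
        + (2 * r) ^ CARD('n) * (\<epsilon> + C * (real CARD('n) / (2 * real N + 2))))"
proof -
  let ?s = "half_shift r U :: real^'n"
  let ?n = "CARD('n)"
  let ?K = "\<lambda>x. cos_kernel r N (x - ?s)"
  define k where "k i t = cos (pi * (t - ?s $ i) / r) ^ (2 * N)" for i t
  define s where "s i t = (sin (pi * (t - ?s $ i) / r))\<^sup>2" for i t
  have k0: "k i t \<ge> 0" for i t
    by (simp add: k_def power_mult)
  have s0: "s i t \<ge> 0" for i t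
    by (simp add: s_def)
  have K: "?K x = (\<Prod>i\<in>UNIV. k i (x $ i))" for x
    by (simp add: cos_kernel_def k_def)
  \<comment> \<open>One and two full periods, written with the number of periods as a visible multiple of \<open>r\<close>.\<close>
  let ?half = "indicator {- (r / 2)..- (r / 2) + real 1 * r} :: real \<Rightarrow> real"
  let ?box = "indicator {- r..- r + real 2 * r} :: real \<Rightarrow> real"
  define H0 where "H0 x = (\<Prod>i\<in>UNIV. ?half (x $ i) * k i (x $ i))" for x :: "real^'n"
  define H1 where "H1 x = (\<Prod>i\<in>UNIV. ?box (x $ i) * k i (x $ i))" for x :: "real^'n"
  define H2 where "H2 j x = (\<Prod>i\<in>UNIV. ?box (x $ i) * k i (x $ i) * (if i = j then s i (x $ i) else 1))"
    for j and x :: "real^'n"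
  define H where "H x = (if U = {} then f 0 else 0) * H0 x + \<epsilon> * H1 x + C * (\<Sum>j\<in>UNIV. H2 j x)" for x
  have int0: "has_bochner_integral lborel H0 (\<Prod>i\<in>(UNIV::'n set). real 1 * r * cos_mean N)"
    unfolding H0_def
  proof (rule has_bochner_integral_prod_coordinates)
    show "has_bochner_integral lborel (\<lambda>t. ?half t * k i t) (real 1 * r * cos_mean N)" for i
      unfolding k_def by (rule has_bochner_integral_cos_power_periods[OF r])
  qed (simp add: k0)
  have box: "has_bochner_integral lborel (\<lambda>t. ?box t * cos (pi * (t - b) / r) ^ (2 * M)) (real 2 * r * cos_mean M)" for b M
    by (rule has_bochner_integral_cos_power_periods[OF r])
  have int1: "has_bochner_integral lborel H1 (\<Prod>i\<in>(UNIV::'n set). real 2 * r * cos_mean N)"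
    unfolding H1_def
  proof (rule has_bochner_integral_prod_coordinates)
    show "has_bochner_integral lborel (\<lambda>t. ?box t * k i t) (real 2 * r * cos_mean N)" for i
      unfolding k_def by (rule box)
  qed (simp add: k0)
  have int2: "has_bochner_integral lborel (H2 j)
      (\<Prod>i\<in>(UNIV::'n set). real 2 * r * cos_mean N * (if i = j then 1 / (2 * real N + 2) else 1))" for j
    unfolding H2_def
  proof (rule has_bochner_integral_prod_coordinates)
    fix i
    show "has_bochner_integral lborel (\<lambda>t. ?box t * k i t * (if i = j then s i t else 1))
        (real 2 * r * cos_mean N * (if i = j then 1 / (2 * real N + 2) else 1))"
    proof (cases "i = j")
      case True
      have "has_bochner_integral lborel
         (\<lambda>t. ?box t * cos (pi * (t - ?s $ i) / r) ^ (2 * N) - ?box t * cos (pi * (t - ?s $ i) / r) ^ (2 * Suc N))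
         (real 2 * r * cos_mean N - real 2 * r * cos_mean (Suc N))"
        by (intro has_bochner_integral_diff box)
      moreover have "real 2 * r * cos_mean N - real 2 * r * cos_mean (Suc N)
          = real 2 * r * cos_mean N * (1 / (2 * real N + 2))"
        using cos_mean_Suc[of N] by (simp add: right_diff_distrib[symmetric])
      moreover have "(\<lambda>t. ?box t * cos (pi * (t - ?s $ i) / r) ^ (2 * N) - ?box t * cos (pi * (t - ?s $ i) / r) ^ (2 * Suc N))
          = (\<lambda>t. ?box t * k i t * s i t)"
        unfolding k_def s_def sin_squared_eq by (simp add: fun_eq_iff power2_eq_square algebra_simps)
      ultimately show ?thesis
        using True by (simp only: if_True simp_thms)
    next
      case False
      then show ?thesis
        using box[of "?s $ i" N] by (simp add: k_def)
    qed
  qed (simp add: k0 s0)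
  have intH: "has_bochner_integral lborel H
      ((if U = {} then f 0 else 0) * (\<Prod>i\<in>(UNIV::'n set). real 1 * r * cos_mean N)
        + \<epsilon> * (\<Prod>i\<in>(UNIV::'n set). real 2 * r * cos_mean N)
        + C * (\<Sum>j\<in>(UNIV::'n set). \<Prod>i\<in>(UNIV::'n set).
            real 2 * r * cos_mean N * (if i = j then 1 / (2 * real N + 2) else 1)))"
    unfolding H_def
    by (intro has_bochner_integral_add has_bochner_integral_mult_right has_bochner_integral_sum int0 int1 int2)
  have H0_nonneg: "H0 x \<ge> 0" and H1_nonneg: "H1 x \<ge> 0" and H2_nonneg: "H2 j x \<ge> 0" for x j
    by (auto simp: H0_def H1_def H2_def k0 s0 intro!: prod_nonneg)
  have H_nonneg: "H x \<ge> 0" for x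
    using f0 \<epsilon> C by (simp add: H_def H0_nonneg H1_nonneg H2_nonneg sum_nonneg)
  have dom: "f x * ?K x \<le> H x" for x
  proof (cases "\<forall>i. \<bar>x $ i\<bar> \<le> r")
    case True
    have box1: "?box (x $ i) = 1" for i
      using True[rule_format, of i] by (auto simp: indicator_def abs_le_iff)
    have H1: "H1 x = ?K x"
      unfolding H1_def K by (simp only: box1 mult_1_left)
    have H2: "H2 j x = s j (x $ j) * ?K x" for j
      unfolding H2_def K by (simp only: box1 mult_1_left prod.distrib) simp
    have H0: "H0 x = (if \<forall>i. \<bar>x $ i\<bar> \<le> r / 2 then ?K x else 0)"
    proof (cases "\<forall>i. \<bar>x $ i\<bar> \<le> r / 2")
      case half: True
      have "?half (x $ i) = 1" for i
        using half[rule_format, of i] by (auto simp: indicator_def abs_le_iff)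
      then show ?thesis
        unfolding H0_def K using half by (simp only: mult_1_left if_True simp_thms)
    next
      case half: False
      then obtain i where "\<not> \<bar>x $ i\<bar> \<le> r / 2" by auto
      then have "?half (x $ i) = 0"
        by (auto simp: indicator_def abs_le_iff)
      then have "H0 x = 0"
        unfolding H0_def by (intro prod_zero) auto
      then show ?thesis using half by (simp only: if_False)
    qed
    have "f x * ?K x \<le> ((if U = {} \<and> (\<forall>i. \<bar>x $ i\<bar> \<le> r / 2) then f 0 else 0) + \<epsilon>
        + C * (\<Sum>i\<in>UNIV. (sin (pi * (x - ?s) $ i / r))\<^sup>2)) * ?K x"
      using True by (intro mult_right_mono maj cos_kernel_nonneg) auto
    also have "\<dots> = H x"
    proof -
      have "(\<Sum>j\<in>UNIV. H2 j x) = (\<Sum>i\<in>UNIV. (sin (pi * (x - ?s) $ i / r))\<^sup>2) * ?K x"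
        by (simp add: H2 s_def sum_distrib_right)
      then show ?thesis
        by (simp add: H_def H0 H1 distrib_right mult.assoc)
    qed
    finally show ?thesis .
  next
    case False
    then obtain i where "\<bar>x $ i\<bar> > r" by (auto simp: not_le)
    then have "norm x \<ge> r"
      using component_le_norm_cart[of x i] by linarith
    then have "f x * ?K x \<le> 0"
      by (intro mult_nonpos_nonneg neg cos_kernel_nonneg)
    then show ?thesis
      using H_nonneg[of x] by linarith
  qed
  have "integral\<^sup>L lborel (\<lambda>x. f x * ?K x) \<le> integral\<^sup>L lborel H"
  proof (rule integral_mono)
    show "integrable lborel H"
      using intH by (simp add: has_bochner_integral_iff)
    have [measurable]: "f \<in> borel_measurable borel"
      using int by auto
    show "integrable lborel (\<lambda>x. f x * ?K x)"
    proof (rule Bochner_Integration.integrable_bound[OF int])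
      show "(\<lambda>x. f x * ?K x) \<in> borel_measurable lborel"
        unfolding cos_kernel_def vector_minus_component by measurable
      have "?K x \<le> 1" for x
        unfolding K by (intro prod_le_1) (simp add: k_def power_mult power_le_one abs_square_le_1)
      then have "\<bar>f x * ?K x\<bar> \<le> \<bar>f x\<bar>" for x
        using cos_kernel_nonneg[of r N "x - ?s"] by (simp add: abs_mult mult_left_le)
      then show "AE x in lborel. norm (f x * ?K x) \<le> norm (f x)"
        by simp
    qed
  qed (rule dom)
  also have "integral\<^sup>L lborel H = cos_mean N ^ ?n * ((if U = {} then r ^ ?n * f 0 else 0)
        + (2 * r) ^ ?n * (\<epsilon> + C * (real ?n / (2 * real N + 2))))"
    using intH by (simp add: has_bochner_integral_iff prod.distrib power_mult_distrib algebra_simps)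
  finally show ?thesis .
qed

text \<open>Translation by \<open>r/2\<close> multiplies the exponential of frequency \<open>(N - j) / r\<close> by the sign
  \<open>(-1)\<^bsup>j + N\<^esup>\<close>; this is how the characters of \<open>F\<^sub>2\<^sup>n\<close> enter.\<close>

lemma cis_half_shift:
  assumes r: "r > 0"
  shows "cis (2 * (real j - real N) * (pi * (x - half_shift r U) $ i / r))
    = (if i \<in> U then (- 1) ^ (j + N) else 1) * cis (- (2 * pi * (x $ i * ((real N - real j) / r))))"
proof (cases "i \<in> U")
  case True
  have "2 * (real j - real N) * (pi * (x - half_shift r U) $ i / r)
      = real N * pi + (- (real j * pi) + (- (2 * pi * (x $ i * ((real N - real j) / r)))))"
    using True r by (simp add: half_shift_def field_simps)
  moreover have "cis (real N * pi) = (-1) ^ N"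
    by (simp add: cis_pi Complex.DeMoivre[symmetric])
  moreover have "cis (- (real j * pi)) = (-1) ^ j"
    by (metis cis_cnj cis_pi Complex.DeMoivre complex_cnj_power complex_cnj_minus complex_cnj_one)
  ultimately show ?thesis
    using True by (simp only: cis_mult[symmetric] if_True power_add) (simp add: mult_ac)
next
  case False
  have "2 * (real j - real N) * (pi * (x - half_shift r U) $ i / r)
      = - (2 * pi * (x $ i * ((real N - real j) / r)))"
    using False r by (simp add: half_shift_def field_simps)
  then show ?thesis
    using False by simp
qed

text \<open>The smoothed form of Poisson summation. After expansion of the kernels, the frequency \<open>y\<close>
  contributes the value of the Fourier transform at \<open>y\<close> times a product of binomial coefficients
  times a character sum of \<open>w\<close>. All three factors are nonnegative, so that dropping every frequency
  except \<open>0\<close> only decreases the sum.\<close>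

lemma sum_integral_cos_kernel_ge:
  fixes f :: "real^'n::finite \<Rightarrow> real" and w :: "'n set \<Rightarrow> real"
  assumes r: "r > 0" and int: "integrable lborel f"
    and fhat: "\<And>y. Re (fourier_transform f y) \<ge> 0"
    and w: "\<And>\<phi>. (\<And>i. \<phi> i = 1 \<or> \<phi> i = - 1) \<Longrightarrow> 0 \<le> (\<Sum>U\<in>UNIV. w U * (\<Prod>i\<in>U. \<phi> i))"
  shows "(\<Sum>U\<in>UNIV. w U * (LINT x|lborel. f x * cos_kernel r N (x - half_shift r U)))
    \<ge> cos_mean N ^ CARD('n) * (\<Sum>U\<in>UNIV. w U) * Re (fourier_transform f 0)"
proof -
  \<comment> \<open>An index \<open>J\<close> picks one exponential for each coordinate, of frequency \<open>(N - J i) / r\<close> in the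
    sign convention of the Fourier transform; the constant term belongs to \<open>J = (\<lambda>_. N)\<close>.\<close>
  define \<J> where "\<J> = PiE (UNIV::'n set) (\<lambda>_. {..2 * N})"
  have fin: "finite \<J>"
    unfolding \<J>_def by (intro finite_PiE) auto
  define B where "B J = (\<Prod>i\<in>(UNIV::'n set). real ((2 * N) choose (J i)) / 4 ^ N)" for J :: "'n \<Rightarrow> nat"
  define y :: "('n \<Rightarrow> nat) \<Rightarrow> real^'n" where "y J = (\<chi> i. (real N - real (J i)) / r)" for J
  define \<sigma> :: "('n \<Rightarrow> nat) \<Rightarrow> 'n set \<Rightarrow> real" where "\<sigma> J U = (\<Prod>i\<in>U. (- 1) ^ (J i + N))" for J U
  have expand: "complex_of_real (cos_kernel r N (x - half_shift r U))
      = (\<Sum>J\<in>\<J>. complex_of_real (B J * \<sigma> J U) * exp (- 2 * complex_of_real pi * \<i> * complex_of_real (x \<bullet> y J)))"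
    for x :: "real^'n" and U
  proof -
    have "complex_of_real (cos_kernel r N (x - half_shift r U))
        = (\<Prod>i\<in>UNIV. \<Sum>j\<le>2 * N. complex_of_real (real ((2 * N) choose j) / 4 ^ N)
            * cis (2 * (real j - real N) * (pi * (x - half_shift r U) $ i / r)))"
      unfolding cos_kernel_def of_real_prod cos_power_eq_cis_sum ..
    also have "\<dots> = (\<Sum>J\<in>\<J>. \<Prod>i\<in>UNIV. complex_of_real (real ((2 * N) choose (J i)) / 4 ^ N)
            * cis (2 * (real (J i) - real N) * (pi * (x - half_shift r U) $ i / r)))"
      unfolding \<J>_def by (rule prod_sum_PiE) auto
    also have "\<dots> = (\<Sum>J\<in>\<J>. complex_of_real (B J * \<sigma> J U) * exp (- 2 * complex_of_real pi * \<i> * complex_of_real (x \<bullet> y J)))"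
    proof (rule sum.cong)
      fix J :: "'n \<Rightarrow> nat"
      have "(\<Prod>i\<in>(UNIV::'n set). if i \<in> U then (- 1) ^ (J i + N) else 1) = complex_of_real (\<sigma> J U)"
        unfolding \<sigma>_def by (simp add: prod.If_cases)
      moreover have "(\<Prod>i\<in>UNIV. cis (- (2 * pi * (x $ i * ((real N - real (J i)) / r)))))
          = exp (- 2 * complex_of_real pi * \<i> * complex_of_real (x \<bullet> y J))"
        by (simp add: cis_conv_exp exp_sum[symmetric] inner_vec_def y_def sum_negf sum_distrib_left mult_ac)
      ultimately show "(\<Prod>i\<in>UNIV. complex_of_real (real ((2 * N) choose (J i)) / 4 ^ N)
            * cis (2 * (real (J i) - real N) * (pi * (x - half_shift r U) $ i / r)))
          = complex_of_real (B J * \<sigma> J U) * exp (- 2 * complex_of_real pi * \<i> * complex_of_real (x \<bullet> y J))"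
        unfolding cis_half_shift[OF r] prod.distrib B_def by (simp only: of_real_prod of_real_mult mult.assoc)
    qed simp
    finally show ?thesis .
  qed
  have [measurable]: "f \<in> borel_measurable borel"
    using int by auto
  have intexp: "integrable lborel (\<lambda>x. complex_of_real (f x) * exp (- 2 * complex_of_real pi * \<i> * complex_of_real (x \<bullet> v)))" for v
  proof (rule Bochner_Integration.integrable_bound[OF int])
    show "(\<lambda>x. complex_of_real (f x) * exp (- 2 * complex_of_real pi * \<i> * complex_of_real (x \<bullet> v))) \<in> borel_measurable lborel"
      by measurable
  qed (simp add: norm_mult)
  have I: "(LINT x|lborel. f x * cos_kernel r N (x - half_shift r U))
      = (\<Sum>J\<in>\<J>. B J * \<sigma> J U * Re (fourier_transform f (y J)))" for U
  proof -
    have "complex_of_real (LINT x|lborel. f x * cos_kernel r N (x - half_shift r U))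
        = (LINT x|lborel. complex_of_real (f x * cos_kernel r N (x - half_shift r U)))"
      by (rule integral_complex_of_real[symmetric])
    also have "\<dots> = (LINT x|lborel. (\<Sum>J\<in>\<J>. complex_of_real (B J * \<sigma> J U)
        * (complex_of_real (f x) * exp (- 2 * complex_of_real pi * \<i> * complex_of_real (x \<bullet> y J)))))"
      unfolding of_real_mult[of "f _"] expand sum_distrib_left by (simp only: mult.left_commute)
    also have "\<dots> = (\<Sum>J\<in>\<J>. LINT x|lborel. complex_of_real (B J * \<sigma> J U)
        * (complex_of_real (f x) * exp (- 2 * complex_of_real pi * \<i> * complex_of_real (x \<bullet> y J))))"
      by (intro Bochner_Integration.integral_sum integrable_mult_right intexp)
    also have "\<dots> = (\<Sum>J\<in>\<J>. complex_of_real (B J * \<sigma> J U) * fourier_transform f (y J))"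
      unfolding fourier_transform_def by (simp only: integral_mult_right_zero)
    finally have "Re (complex_of_real (LINT x|lborel. f x * cos_kernel r N (x - half_shift r U)))
        = Re (\<Sum>J\<in>\<J>. complex_of_real (B J * \<sigma> J U) * fourier_transform f (y J))"
      by (simp only:)
    then show ?thesis
      by simp
  qed
  define T where "T J = B J * (\<Sum>U\<in>UNIV. w U * \<sigma> J U) * Re (fourier_transform f (y J))" for J
  have "(\<Sum>U\<in>UNIV. w U * (LINT x|lborel. f x * cos_kernel r N (x - half_shift r U)))
      = (\<Sum>U\<in>UNIV. \<Sum>J\<in>\<J>. B J * (w U * \<sigma> J U) * Re (fourier_transform f (y J)))"
    unfolding I by (simp add: sum_distrib_left mult_ac)
  also have "\<dots> = (\<Sum>J\<in>\<J>. T J)"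
    unfolding T_def sum_distrib_left sum_distrib_right by (rule sum.swap)
  also have "\<dots> \<ge> T (\<lambda>_. N)"
  proof (rule member_le_sum)
    show "(\<lambda>_. N) \<in> \<J>"
      by (simp add: \<J>_def PiE_UNIV_domain)
    fix J :: "'n \<Rightarrow> nat"
    have "0 \<le> (\<Sum>U\<in>UNIV. w U * \<sigma> J U)"
      unfolding \<sigma>_def by (rule w) (metis neg_one_even_power neg_one_odd_power)
    moreover have "B J \<ge> 0"
      unfolding B_def by (intro prod_nonneg) simp
    ultimately show "0 \<le> T J"
      unfolding T_def using fhat by simp
  qed (rule fin)
  also have "T (\<lambda>_. N) = cos_mean N ^ CARD('n) * (\<Sum>U\<in>UNIV. w U) * Re (fourier_transform f 0)"
  proof -
    have "y (\<lambda>_. N) = 0"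
      by (simp add: y_def vec_eq_iff)
    moreover have "\<sigma> (\<lambda>_. N) U = 1" for U
      by (simp add: \<sigma>_def)
    moreover have "B (\<lambda>_. N) = cos_mean N ^ CARD('n)"
      by (simp add: B_def cos_mean_def)
    ultimately show ?thesis
      by (simp add: T_def)
  qed
  finally show ?thesis .
qed

section \<open>Delsarte weights and the Cohn-Elkies bound\<close>

text \<open>Delsarte's linear program as a source of lower bounds. The two estimates are compared after
  cancelling \<open>cos_mean N ^ n\<close>; the error \<open>\<epsilon>\<close> of the majorant is chosen first, and \<open>N\<close> afterwards,
  large in comparison with the constant \<open>C\<close> that belongs to \<open>\<epsilon>\<close>.\<close>

theorem delsarte_weight_bound:
  fixes f :: "real^'n::finite \<Rightarrow> real" and w :: "'n set \<Rightarrow> real"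
  assumes r: "r > 0" and cont: "continuous_on UNIV f" and f0: "f 0 \<ge> 0"
    and neg: "\<And>x. norm x \<ge> r \<Longrightarrow> f x \<le> 0"
    and fhat0: "Re (fourier_transform f 0) \<ge> 1"
    and fhat: "\<And>y. Re (fourier_transform f y) \<ge> 0"
    and w_empty: "w {} = 1" and w_nonneg: "\<And>U. w U \<ge> 0"
    and w_supp: "\<And>U. w U \<noteq> 0 \<Longrightarrow> U = {} \<or> card U \<ge> 4"
    and w: "\<And>\<phi>. (\<And>i. \<phi> i = 1 \<or> \<phi> i = - 1) \<Longrightarrow> 0 \<le> (\<Sum>U\<in>UNIV. w U * (\<Prod>i\<in>U. \<phi> i))"
  shows "(\<Sum>U\<in>UNIV. w U) \<le> r ^ CARD('n) * f 0"
proof (rule field_le_epsilon)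
  fix e :: real assume e: "e > 0"
  let ?n = "CARD('n)"
  define S where "S = (\<Sum>U\<in>UNIV. w U)"
  have "w {} \<le> S"
    unfolding S_def by (rule member_le_sum) (auto simp: w_nonneg)
  then have S: "S \<ge> 1" by (simp add: w_empty)
  \<comment> \<open>The integral of a non-integrable function is \<open>0\<close> by convention, which the bound on the
    Fourier transform at \<open>0\<close> excludes.\<close>
  have int: "integrable lborel f"
  proof (rule ccontr)
    assume "\<not> integrable lborel f"
    then have "fourier_transform f 0 = 0"
      unfolding fourier_transform_def by (simp add: not_integrable_integral_eq)
    with fhat0 show False by simp
  qed
  define D where "D = S * (2 * r) ^ ?n"
  have D: "D > 0" using S r by (simp add: D_def)
  define \<epsilon> where "\<epsilon> = e / (2 * D)"
  have \<epsilon>: "\<epsilon> > 0" using e D by (simp add: \<epsilon>_def)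
  obtain C where C: "C \<ge> 0"
    and maj: "\<And>U x. U = {} \<or> card U \<ge> 4 \<Longrightarrow> (\<And>i. \<bar>x $ i\<bar> \<le> r) \<Longrightarrow>
      f x \<le> (if U = {} \<and> (\<forall>i. \<bar>x $ i\<bar> \<le> r / 2) then f 0 else 0) + \<epsilon>
        + C * (\<Sum>i\<in>UNIV. (sin (pi * (x - half_shift r U) $ i / r))\<^sup>2)"
    using pointwise_majorant[OF r cont f0 neg \<epsilon>] by blast
  obtain N :: nat where N: "C * real ?n / \<epsilon> < real N"
    using reals_Archimedean2 by blast
  have N': "C * (real ?n / (2 * real N + 2)) \<le> \<epsilon>"
  proof -
    have "C * real ?n \<le> \<epsilon> * real N"
      using N \<epsilon> by (simp add: pos_divide_less_eq mult.commute)
    also have "\<dots> \<le> \<epsilon> * (2 * real N + 2)"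
      using \<epsilon> by (intro mult_left_mono) auto
    finally show ?thesis
      by (simp add: pos_divide_le_eq)
  qed
  define a where "a = cos_mean N ^ ?n"
  have a: "a > 0" by (simp add: a_def cos_mean_pos)
  have "a * S * 1 \<le> a * S * Re (fourier_transform f 0)"
    using fhat0 a S by (intro mult_left_mono) auto
  also have "\<dots> \<le> (\<Sum>U\<in>UNIV. w U * (LINT x|lborel. f x * cos_kernel r N (x - half_shift r U)))"
    unfolding a_def S_def by (rule sum_integral_cos_kernel_ge[OF r int fhat w])
  also have "\<dots> \<le> (\<Sum>U\<in>UNIV. w U * (a * ((if U = {} then r ^ ?n * f 0 else 0) + (2 * r) ^ ?n * (2 * \<epsilon>))))"
  proof (rule sum_mono)
    fix U :: "'n set"
    show "w U * (LINT x|lborel. f x * cos_kernel r N (x - half_shift r U))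
      \<le> w U * (a * ((if U = {} then r ^ ?n * f 0 else 0) + (2 * r) ^ ?n * (2 * \<epsilon>)))"
    proof (cases "w U = 0")
      case False
      from w_supp[OF this] have "(LINT x|lborel. f x * cos_kernel r N (x - half_shift r U))
        \<le> a * ((if U = {} then r ^ ?n * f 0 else 0) + (2 * r) ^ ?n * (\<epsilon> + C * (real ?n / (2 * real N + 2))))"
        unfolding a_def by (intro integral_cos_kernel_le r int f0 neg maj C less_imp_le[OF \<epsilon>])
      also have "\<dots> \<le> a * ((if U = {} then r ^ ?n * f 0 else 0) + (2 * r) ^ ?n * (2 * \<epsilon>))"
        using N' a r by (intro mult_left_mono add_left_mono) auto
      finally show ?thesis
        by (intro mult_left_mono w_nonneg)
    qed simp
  qed
  also have "\<dots> = a * (r ^ ?n * f 0 + D * (2 * \<epsilon>))"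
  proof -
    have "w U * (a * ((if U = {} then r ^ ?n * f 0 else 0) + (2 * r) ^ ?n * (2 * \<epsilon>)))
      = a * (if U = {} then r ^ ?n * f 0 else 0) + w U * (a * ((2 * r) ^ ?n * (2 * \<epsilon>)))" for U
      using w_empty by (simp add: distrib_left)
    then show ?thesis
      by (simp only: sum.distrib sum_distrib_left[symmetric] sum_distrib_right[symmetric] S_def[symmetric] D_def)
        (simp add: algebra_simps)
  qed
  also have "\<dots> = a * (r ^ ?n * f 0 + e)"
    using D by (simp add: \<epsilon>_def)
  finally have "a * S \<le> a * (r ^ ?n * f 0 + e)"
    by simp
  then show "(\<Sum>U\<in>UNIV. w U) \<le> r ^ ?n * f 0 + e"
    using a unfolding S_def by (simp only: mult_le_cancel_left_pos)
qed

text \<open>Since \<open>\<Prod>\<^sub>i (1 + \<phi>\<^sub>i z)\<close> is the generating function of the products of \<open>\<phi>\<close> over the subsets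
  \<open>U\<close> by cardinality, a sum over \<open>2\<^sup>n\<close> subsets with weights that depend on the cardinality only
  reduces to the coefficients of one polynomial. For signs \<open>\<phi>\<close> these are the values of the
  Krawtchouk polynomials.\<close>

lemma sum_subset_card_prod:
  fixes \<phi> :: "'n::finite \<Rightarrow> real"
  shows "(\<Sum>U\<in>UNIV. W (card U) * (\<Prod>i\<in>U. \<phi> i)) = (\<Sum>j\<le>CARD('n). W j * coeff (\<Prod>i\<in>UNIV. [:1, \<phi> i:]) j)"
proof -
  have "(\<Prod>i\<in>UNIV. [:1, \<phi> i:]) = (\<Prod>i\<in>UNIV. monom (\<phi> i) 1 + 1)"
    by (intro prod.cong) (simp_all add: monom_Suc monom_0 one_pCons)
  also have "\<dots> = (\<Sum>U\<in>UNIV. \<Prod>i\<in>U. monom (\<phi> i) 1)"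
    by (subst prod_add) simp_all
  also have "\<dots> = (\<Sum>U\<in>UNIV. monom (\<Prod>i\<in>U. \<phi> i) (card U))"
  proof (rule sum.cong)
    fix U :: "'n set"
    show "(\<Prod>i\<in>U. monom (\<phi> i) 1) = monom (\<Prod>i\<in>U. \<phi> i) (card U)"
      by (induction U rule: infinite_finite_induct) (simp_all add: mult_monom)
  qed simp
  finally have "coeff (\<Prod>i\<in>UNIV. [:1, \<phi> i:]) j = (\<Sum>U\<in>UNIV. if card U = j then \<Prod>i\<in>U. \<phi> i else 0)" for j
    by (simp add: coeff_sum)
  then have "(\<Sum>j\<le>CARD('n). W j * coeff (\<Prod>i\<in>UNIV. [:1, \<phi> i:]) j)
      = (\<Sum>j\<le>CARD('n). \<Sum>U\<in>UNIV. if card U = j then W j * (\<Prod>i\<in>U. \<phi> i) else 0)"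
    by (simp add: sum_distrib_left if_distrib cong: if_cong)
  also have "\<dots> = (\<Sum>U\<in>UNIV. \<Sum>j\<le>CARD('n). if card U = j then W j * (\<Prod>i\<in>U. \<phi> i) else 0)"
    by (rule sum.swap)
  also have "\<dots> = (\<Sum>U\<in>UNIV. W (card U) * (\<Prod>i\<in>U. \<phi> i))"
    by (simp add: card_mono)
  finally show ?thesis ..
qed

text \<open>Multiplied by \<open>11 choose j\<close>, these values give the distance distribution
  \<open>1, 110/3, 88/3, 55/3\<close> in the distances \<open>0, 4, 6, 8\<close>. It maximises the total mass in Delsarte's
  linear program for length 11 and minimum distance 4 with even distances.\<close>

definition code_weight :: "nat \<Rightarrow> real"
  where "code_weight j = (if j = 0 then 1 else if j = 4 then 1 / 9 else if j = 6 then 4 / 63 else if j = 8 then 1 / 9 else 0)"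

text \<open>The Krawtchouk transform of the weight, whose value at \<open>k = 0\<close> is the total mass. The zeros
  are the constraints of the linear program that are active at its optimum; the symmetry under
  \<open>k \<mapsto> 11 - k\<close> comes from the weight living on even cardinalities.\<close>

lemma code_weight_transform:
  assumes "k \<le> 11"
  shows "(\<Sum>j\<le>11. code_weight j * coeff ([:1, 1:] ^ (11 - k) * [:1, - 1:] ^ k) j)
    = (if k = 0 \<or> k = 11 then 256 / 3 else if k = 5 \<or> k = 6 then 128 / 63 else 0)"
proof -
  have "k \<in> {0, 1, 2, 3, 4, 5, 6, 7, 8, 9, 10, 11}"
    using assms by simp presburger
  then show ?thesis
    by (auto simp: code_weight_def eval_nat_numeral)
qed

lemma code_weight_character_sum:
  fixes \<phi> :: "11 \<Rightarrow> real"
  assumes "\<And>i. \<phi> i = 1 \<or> \<phi> i = - 1"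
  defines "k \<equiv> card {i. \<phi> i = - 1}"
  shows "(\<Sum>U\<in>UNIV. code_weight (card U) * (\<Prod>i\<in>U. \<phi> i))
    = (if k = 0 \<or> k = 11 then 256 / 3 else if k = 5 \<or> k = 6 then 128 / 63 else 0)"
proof -
  have "(\<Prod>i\<in>UNIV. [:1, \<phi> i:]) = (\<Prod>i\<in>UNIV. if \<phi> i = - 1 then [:1, - 1:] else [:1, 1:])"
    using assms(1) by (intro prod.cong) auto
  also have "\<dots> = [:1, - 1:] ^ k * [:1, 1:] ^ card (- {i. \<phi> i = - 1})"
    by (simp add: prod.If_cases k_def)
  also have "card (- {i. \<phi> i = - 1}) = 11 - k"
    by (simp add: Compl_eq_Diff_UNIV card_Diff_subset k_def)
  also have "[:1, - 1:] ^ k * [:1, 1:] ^ (11 - k) = [:1, 1:] ^ (11 - k) * [:1, - 1 :: real:] ^ k"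
    by (rule mult.commute)
  finally have "(\<Sum>U\<in>UNIV. code_weight (card U) * (\<Prod>i\<in>U. \<phi> i))
      = (\<Sum>j\<le>11. code_weight j * coeff ([:1, 1:] ^ (11 - k) * [:1, - 1:] ^ k) j)"
    by (simp add: sum_subset_card_prod)
  moreover have "k \<le> 11"
    using card_mono[of UNIV "{i. \<phi> i = - 1}"] by (simp add: k_def)
  ultimately show ?thesis
    by (simp only: code_weight_transform)
qed

theorem theorem8p5:
  fixes r :: real
  assumes "r > 0"
  shows "cohn_elkies_bound TYPE(11) r \<ge> ereal (1 / 24) \<and> (1 / 24 :: real) > 0.04166666"
proof
  show "cohn_elkies_bound TYPE(11) r \<ge> ereal (1 / 24)"
    unfolding cohn_elkies_bound_def
  proof (rule INF_greatest)
    fix f :: "real^11 \<Rightarrow> real"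
    assume f: "f \<in> cohn_elkies_feasible r"
    then have "times_cont_diff 0 f"
      unfolding cohn_elkies_feasible_def smooth_def by blast
    then have cont: "continuous_on UNIV f" by simp
    have "(\<Sum>U\<in>UNIV. code_weight (card (U :: 11 set))) \<le> r ^ CARD(11) * f 0"
    proof (rule delsarte_weight_bound[OF assms cont])
      show "code_weight (card ({} :: 11 set)) = 1"
        by (simp add: code_weight_def)
      show "0 \<le> code_weight (card U)" for U :: "11 set"
        by (simp add: code_weight_def)
      show "U = {} \<or> 4 \<le> card U" if "code_weight (card U) \<noteq> 0" for U :: "11 set"
        using that by (auto simp: code_weight_def split: if_splits)
      show "0 \<le> (\<Sum>U\<in>UNIV. code_weight (card U) * (\<Prod>i\<in>U. \<phi> i))"
        if "\<And>i. \<phi> i = 1 \<or> \<phi> i = - 1" for \<phi> :: "11 \<Rightarrow> real"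
        using code_weight_character_sum[of \<phi>] that by simp
    qed (use f in \<open>auto simp: cohn_elkies_feasible_def\<close>)
    moreover have "(\<Sum>U\<in>UNIV. code_weight (card (U :: 11 set))) = 256 / 3"
      using code_weight_character_sum[of "\<lambda>_. 1"] by simp
    ultimately show "ereal (1 / 24) \<le> ereal ((r / 2) ^ CARD(11) * f 0)"
      by (simp add: power_divide)
  qed
qed simp

end
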